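(* Up to saturation with respect to the product of the $26$ variables $p_{ij}$ ($1\le i<j\le5$), $E_i$ ($1\le i\le 5$), $F_{ij}$ ($1\le i<j\le5$), $G$, the universal Cox ideal $I_{\mathcal{Y}}$ for degree $4$ del Pezzo surfaces is generated by the following $45$ trinomials. Base group: $p_{12}p_{34}-p_{13}p_{24}+p_{14}p_{23}$, $p_{12}p_{35}-p_{13}p_{25}+p_{15}p_{23}$, $p_{12}p_{45}-p_{14}p_{25}+p_{15}p_{24}$, $p_{13}p_{45}-p_{14}p_{35}+p_{15}p_{34}$, $p_{23}p_{45}-p_{24}p_{35}+p_{25}p_{34}$. Group 1: $F_{23}F_{45}-F_{24}F_{35}+F_{25}F_{34}$, $p_{23}p_{45}F_{24}F_{35}-p_{24}p_{35}F_{23}F_{45}-GE_1$, $p_{23}p_{45}F_{25}F_{34}-p_{25}p_{34}F_{23}F_{45}-GE_1$, $p_{24}p_{35}F_{25}F_{34}-p_{25}p_{34}F_{24}F_{35}-GE_1$. Group 2: $F_{13}F_{45}-F_{14}F_{35}+F_{15}F_{34}$, $p_{13}p_{45}F_{14}F_{35}-p_{14}p_{35}F_{13}F_{45}-GE_2$, $p_{13}p_{45}F_{15}F_{34}-p_{15}p_{34}F_{13}F_{45}-GE_2$, $p_{14}p_{35}F_{15}F_{34}-p_{15}p_{34}F_{14}F_{35}-GE_2$. Group 3: $F_{12}F_{45}-F_{14}F_{25}+F_{15}F_{24}$, $p_{12}p_{45}F_{14}F_{25}-p_{14}p_{25}F_{12}F_{45}-GE_3$, $p_{12}p_{45}F_{15}F_{24}-p_{15}p_{24}F_{12}F_{45}-GE_3$,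 $p_{14}p_{25}F_{15}F_{24}-p_{15}p_{24}F_{14}F_{25}-GE_3$. Group 4: $F_{12}F_{35}-F_{13}F_{25}+F_{15}F_{23}$, $p_{12}p_{35}F_{13}F_{25}-p_{13}p_{25}F_{12}F_{35}-GE_4$, $p_{12}p_{35}F_{15}F_{23}-p_{15}p_{23}F_{12}F_{35}-GE_4$, $p_{13}p_{25}F_{15}F_{23}-p_{15}p_{23}F_{13}F_{25}-GE_4$. Group 5: $F_{12}F_{34}-F_{13}F_{24}+F_{14}F_{23}$, $p_{12}p_{34}F_{13}F_{24}-p_{13}p_{24}F_{12}F_{34}-GE_5$, $p_{12}p_{34}F_{14}F_{23}-p_{14}p_{23}F_{12}F_{34}-GE_5$, $p_{13}p_{24}F_{14}F_{23}-p_{14}p_{23}F_{13}F_{24}-GE_5$. Group 1': $p_{25}F_{12}E_2-p_{35}F_{13}E_3+p_{45}F_{14}E_4$, $p_{24}F_{12}E_2-p_{34}F_{13}E_3+p_{45}F_{15}E_5$, $p_{23}F_{12}E_2-p_{34}F_{14}E_4+p_{35}F_{15}E_5$, $p_{23}F_{13}E_3-p_{24}F_{14}E_4+p_{25}F_{15}E_5$. Group 2': $p_{15}F_{12}E_1-p_{35}F_{23}E_3+p_{45}F_{24}E_4$, $p_{14}F_{12}E_1-p_{34}F_{23}E_3+p_{45}F_{25}E_5$, $p_{13}F_{12}E_1-p_{34}F_{24}E_4+p_{35}F_{25}E_5$, $p_{13}F_{23}E_3-p_{14}F_{24}E_4+p_{15}F_{25}E_5$. Group 3': $p_{15}F_{13}E_1-p_{25}F_{23}E_2+p_{45}F_{34}E_4$,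 $p_{14}F_{13}E_1-p_{24}F_{23}E_2+p_{45}F_{35}E_5$, $p_{12}F_{13}E_1-p_{24}F_{34}E_4+p_{25}F_{35}E_5$, $p_{12}F_{23}E_2-p_{14}F_{34}E_4+p_{15}F_{35}E_5$. Group 4': $p_{15}F_{14}E_1-p_{25}F_{24}E_2+p_{35}F_{34}E_3$, $p_{13}F_{14}E_1-p_{23}F_{24}E_2+p_{35}F_{45}E_5$, $p_{12}F_{14}E_1-p_{23}F_{34}E_3+p_{25}F_{45}E_5$, $p_{12}F_{24}E_2-p_{13}F_{34}E_3+p_{15}F_{45}E_5$. Group 5': $p_{14}F_{15}E_1-p_{24}F_{25}E_2+p_{34}F_{35}E_3$, $p_{13}F_{15}E_1-p_{23}F_{25}E_2+p_{34}F_{45}E_4$, $p_{12}F_{15}E_1-p_{23}F_{35}E_3+p_{24}F_{45}E_4$, $p_{12}F_{25}E_2-p_{13}F_{35}E_3+p_{14}F_{45}E_4$.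
   Context: $K$ is a field of characteristic $0$. A degree $4$ del Pezzo surface $X$ is the blow-up of $\mathbb{P}^2$ at five general points $v_1,\dots,v_5$. Its Cox ring $\mathrm{Cox}(X)=\bigoplus_{\mathcal L\in\mathrm{Pic}(X)}H^0(X,\mathcal L)$ is generated by sections $E_i,F_{ij},G$ cutting out the $16$ $(-1)$-curves: $E_i$ is the exceptional divisor over point $i$, $F_{ij}$ the line through points $i,j$, and $G$ the conic through the five points. Moduli are given by points $(p_{12},\dots,p_{45})$ of $M_{0,5}$, where the $p_{ij}$ are the Plücker coordinates of the kernel of the $3\times5$-matrix $(v_1,\dots,v_5)$ (up to harmless sign changes coming from rescaling coordinates by $\pm1$). The universal Cox ring is the quotient $K[p_{ij},E_i,F_{ij},G]/I_{\mathcal{Y}}$ of the polynomial ring in $26=10+16$ variables, where the universal Cox ideal $I_{\mathcal Y}$ is the ideal of all relations among the $p_{ij}$ and the Cox ring generators over the moduli space. Explicitly: let $V=(v_1,\dots,v_5)$ be a $3\times 5$ matrix of indeterminates, $x$ a vector of three indeterminates, $t_1,\dots,t_5$ further indeterminates, $[ijk]=\det(v_i,v_j,v_k)$ and $\ell_{ij}=\det(v_i,v_j,x)$. Then $I_{\mathcal Y}$ is the kernel of the $K$-algebra homomorphism from the polynomial ring to $K[V,x,t_1^{\pm1},\dots,t_5^{\pm1}]$ given by $p_{kl}\mapsto[ijm]$ for $k<l$, $i<j<m$, $\{i,j,k,l,m\}=\{1,\dots,5\}$; $E_i\mapsto t_i$; $F_{ij}\mapsto \ell_{ij}/(t_it_j)$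 for $i<j$; $G\mapsto([123][145]\ell_{24}\ell_{35}-[124][135]\ell_{23}\ell_{45})/(t_1t_2t_3t_4t_5)$. "Generated up to saturation" means that the two ideals have the same saturation with respect to the product of the $26$ variables, equivalently the same extension to the Laurent polynomial ring in the $26$ variables. *)

theory Defs
  imports "HOL-Analysis.Analysis" "HOL-Library.Poly_Mapping"
begin

text \<open>The polynomial ring over \<open>'a\<close> in the variables \<open>'v\<close> is the monoid ring of the
  finitely supported exponent vectors \<open>'v \<Rightarrow>\<^sub>0 nat\<close>; integer exponents give Laurent polynomials.\<close>

type_synonym ('v, 'a) mpoly = "('v \<Rightarrow>\<^sub>0 nat) \<Rightarrow>\<^sub>0 'a"
type_synonym ('v, 'a) laurent = "('v \<Rightarrow>\<^sub>0 int) \<Rightarrow>\<^sub>0 'a"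

definition Var :: "'v \<Rightarrow> ('v, 'a::comm_ring_1) mpoly"
  where "Var v = Poly_Mapping.single (Poly_Mapping.single v 1) 1"

definition const :: "'a::comm_ring_1 \<Rightarrow> ('m::comm_monoid_add \<Rightarrow>\<^sub>0 'a)"
  where "const a = Poly_Mapping.single 0 a"

text \<open>The substitution homomorphism extending \<open>c\<close> on coefficients and \<open>g\<close> on variables
  (a homomorphism whenever \<open>c\<close> is one).\<close>

definition poly_subst ::
    "('a::comm_ring_1 \<Rightarrow> 'b::comm_ring_1) \<Rightarrow> ('v \<Rightarrow> 'b) \<Rightarrow> ('v, 'a) mpoly \<Rightarrow> 'b"
  where "poly_subst c g f =
    (\<Sum>m\<in>Poly_Mapping.keys f. c (Poly_Mapping.lookup f m) *
       (\<Prod>v\<in>Poly_Mapping.keys m. g v ^ Poly_Mapping.lookup m v))"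

text \<open>An ideal of a commutative ring is a submodule of the ring over itself.\<close>

definition ideal_generated :: "'a::comm_ring_1 set \<Rightarrow> 'a set"
  where "ideal_generated S = module.span (*) S"

definition saturation :: "'a::comm_ring_1 set \<Rightarrow> 'a \<Rightarrow> 'a set"
  where "saturation I h = {f. \<exists>n::nat. h ^ n * f \<in> I}"

datatype cox_var =
    P12 | P13 | P14 | P15 | P23 | P24 | P25 | P34 | P35 | P45
  | E1 | E2 | E3 | E4 | E5
  | F12 | F13 | F14 | F15 | F23 | F24 | F25 | F34 | F35 | F45
  | G

lemma UNIV_cox_var:
  "UNIV = {P12, P13, P14, P15, P23, P24, P25, P34, P35, P45,
     E1, E2, E3, E4, E5,
     F12, F13, F14, F15, F23, F24, F25, F34, F35, F45, G}"
  using cox_var.exhaust by auto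

instance cox_var :: finite
  by standard (simp add: UNIV_cox_var)

type_synonym 'k cox_poly = "(cox_var, 'k) mpoly"

text \<open>The ring \<open>K[V, x, t\<^sub>1\<^sup>\<plusminus>\<^sup>1, \<dots>, t\<^sub>5\<^sup>\<plusminus>\<^sup>1]\<close> is built as \<open>K[V, x][t\<^sub>1\<^sup>\<plusminus>\<^sup>1, \<dots>, t\<^sub>5\<^sup>\<plusminus>\<^sup>1]\<close>. The points are
  indexed by the five-element type \<open>5\<close>, in which the numerals 1 to 5 are distinct (and 5 = 0);
  likewise for the coordinates and the type \<open>3\<close>.\<close>

datatype vx_var = V_entry 3 5 | x_entry 3

type_synonym 'k vx_poly = "(vx_var, 'k) mpoly"
type_synonym 'k target = "(5, 'k vx_poly) laurent"

definition V_matrix :: "'k::field vx_poly ^ 5 ^ 3"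
  where "V_matrix = (\<chi> r i. Var (V_entry r i))"

definition x_vector :: "'k::field vx_poly ^ 3"
  where "x_vector = (\<chi> r. Var (x_entry r))"

definition det_columns :: "'a::comm_ring_1 ^ 3 \<Rightarrow> 'a ^ 3 \<Rightarrow> 'a ^ 3 \<Rightarrow> 'a"
  where "det_columns a b c = det (transpose (vector [a, b, c]))"

definition bracket :: "5 \<Rightarrow> 5 \<Rightarrow> 5 \<Rightarrow> 'k::field vx_poly"
  where "bracket i j k = det_columns (column i V_matrix) (column j V_matrix) (column k V_matrix)"

definition ell :: "5 \<Rightarrow> 5 \<Rightarrow> 'k::field vx_poly"
  where "ell i j = det_columns (column i V_matrix) (column j V_matrix) x_vector"

definition t_power :: "5 \<Rightarrow> int \<Rightarrow> 'k::field target"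
  where "t_power i e = Poly_Mapping.single (Poly_Mapping.single i e) 1"

text \<open>Up to sign, the minors of \<open>V\<close> complementary to \<open>k, l\<close> are the Pluecker coordinates \<open>p\<^sub>k\<^sub>l\<close> of
  the kernel of \<open>V\<close>; the sign convention used here makes all relations below hold verbatim.\<close>

primrec cox_image :: "cox_var \<Rightarrow> 'k::field target"
  where
    "cox_image P12 = const (bracket 3 4 5)"
  | "cox_image P13 = const (bracket 2 4 5)"
  | "cox_image P14 = const (bracket 2 3 5)"
  | "cox_image P15 = const (bracket 2 3 4)"
  | "cox_image P23 = const (bracket 1 4 5)"
  | "cox_image P24 = const (bracket 1 3 5)"
  | "cox_image P25 = const (bracket 1 3 4)"
  | "cox_image P34 = const (bracket 1 2 5)"
  | "cox_image P35 = const (bracket 1 2 4)"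
  | "cox_image P45 = const (bracket 1 2 3)"
  | "cox_image E1 = t_power 1 1"
  | "cox_image E2 = t_power 2 1"
  | "cox_image E3 = t_power 3 1"
  | "cox_image E4 = t_power 4 1"
  | "cox_image E5 = t_power 5 1"
  | "cox_image F12 = const (ell 1 2) * t_power 1 (-1) * t_power 2 (-1)"
  | "cox_image F13 = const (ell 1 3) * t_power 1 (-1) * t_power 3 (-1)"
  | "cox_image F14 = const (ell 1 4) * t_power 1 (-1) * t_power 4 (-1)"
  | "cox_image F15 = const (ell 1 5) * t_power 1 (-1) * t_power 5 (-1)"
  | "cox_image F23 = const (ell 2 3) * t_power 2 (-1) * t_power 3 (-1)"
  | "cox_image F24 = const (ell 2 4) * t_power 2 (-1) * t_power 4 (-1)"
  | "cox_image F25 = const (ell 2 5) * t_power 2 (-1) * t_power 5 (-1)"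
  | "cox_image F34 = const (ell 3 4) * t_power 3 (-1) * t_power 4 (-1)"
  | "cox_image F35 = const (ell 3 5) * t_power 3 (-1) * t_power 5 (-1)"
  | "cox_image F45 = const (ell 4 5) * t_power 4 (-1) * t_power 5 (-1)"
  | "cox_image G =
     const (bracket 1 2 3 * bracket 1 4 5 * ell 2 4 * ell 3 5
          - bracket 1 2 4 * bracket 1 3 5 * ell 2 3 * ell 4 5)
     * t_power 1 (-1) * t_power 2 (-1) * t_power 3 (-1) * t_power 4 (-1) * t_power 5 (-1)"

definition cox_map :: "'k::field cox_poly \<Rightarrow> 'k target"
  where "cox_map = poly_subst (\<lambda>a. const (const a)) cox_image"

definition universal_cox_ideal :: "'k::field cox_poly set"
  where "universal_cox_ideal = {f. cox_map f = 0}"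

definition trinomials :: "'k::field cox_poly set"
  where "trinomials = {
   Var P12 * Var P34 - Var P13 * Var P24 + Var P14 * Var P23,
   Var P12 * Var P35 - Var P13 * Var P25 + Var P15 * Var P23,
   Var P12 * Var P45 - Var P14 * Var P25 + Var P15 * Var P24,
   Var P13 * Var P45 - Var P14 * Var P35 + Var P15 * Var P34,
   Var P23 * Var P45 - Var P24 * Var P35 + Var P25 * Var P34,

   Var F23 * Var F45 - Var F24 * Var F35 + Var F25 * Var F34,
   Var P23 * Var P45 * Var F24 * Var F35 - Var P24 * Var P35 * Var F23 * Var F45 - Var G * Var E1,
   Var P23 * Var P45 * Var F25 * Var F34 - Var P25 * Var P34 * Var F23 * Var F45 - Var G * Var E1,
   Var P24 * Var P35 * Var F25 * Var F34 - Var P25 * Var P34 * Var F24 * Var F35 - Var G * Var E1,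

   Var F13 * Var F45 - Var F14 * Var F35 + Var F15 * Var F34,
   Var P13 * Var P45 * Var F14 * Var F35 - Var P14 * Var P35 * Var F13 * Var F45 - Var G * Var E2,
   Var P13 * Var P45 * Var F15 * Var F34 - Var P15 * Var P34 * Var F13 * Var F45 - Var G * Var E2,
   Var P14 * Var P35 * Var F15 * Var F34 - Var P15 * Var P34 * Var F14 * Var F35 - Var G * Var E2,

   Var F12 * Var F45 - Var F14 * Var F25 + Var F15 * Var F24,
   Var P12 * Var P45 * Var F14 * Var F25 - Var P14 * Var P25 * Var F12 * Var F45 - Var G * Var E3,
   Var P12 * Var P45 * Var F15 * Var F24 - Var P15 * Var P24 * Var F12 * Var F45 - Var G * Var E3,
   Var P14 * Var P25 * Var F15 * Var F24 - Var P15 * Var P24 * Var F14 * Var F25 - Var G * Var E3,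

   Var F12 * Var F35 - Var F13 * Var F25 + Var F15 * Var F23,
   Var P12 * Var P35 * Var F13 * Var F25 - Var P13 * Var P25 * Var F12 * Var F35 - Var G * Var E4,
   Var P12 * Var P35 * Var F15 * Var F23 - Var P15 * Var P23 * Var F12 * Var F35 - Var G * Var E4,
   Var P13 * Var P25 * Var F15 * Var F23 - Var P15 * Var P23 * Var F13 * Var F25 - Var G * Var E4,

   Var F12 * Var F34 - Var F13 * Var F24 + Var F14 * Var F23,
   Var P12 * Var P34 * Var F13 * Var F24 - Var P13 * Var P24 * Var F12 * Var F34 - Var G * Var E5,
   Var P12 * Var P34 * Var F14 * Var F23 - Var P14 * Var P23 * Var F12 * Var F34 - Var G * Var E5,
   Var P13 * Var P24 * Var F14 * Var F23 - Var P14 * Var P23 * Var F13 * Var F24 - Var G * Var E5,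

   Var P25 * Var F12 * Var E2 - Var P35 * Var F13 * Var E3 + Var P45 * Var F14 * Var E4,
   Var P24 * Var F12 * Var E2 - Var P34 * Var F13 * Var E3 + Var P45 * Var F15 * Var E5,
   Var P23 * Var F12 * Var E2 - Var P34 * Var F14 * Var E4 + Var P35 * Var F15 * Var E5,
   Var P23 * Var F13 * Var E3 - Var P24 * Var F14 * Var E4 + Var P25 * Var F15 * Var E5,

   Var P15 * Var F12 * Var E1 - Var P35 * Var F23 * Var E3 + Var P45 * Var F24 * Var E4,
   Var P14 * Var F12 * Var E1 - Var P34 * Var F23 * Var E3 + Var P45 * Var F25 * Var E5,
   Var P13 * Var F12 * Var E1 - Var P34 * Var F24 * Var E4 + Var P35 * Var F25 * Var E5,
   Var P13 * Var F23 * Var E3 - Var P14 * Var F24 * Var E4 + Var P15 * Var F25 * Var E5,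

   Var P15 * Var F13 * Var E1 - Var P25 * Var F23 * Var E2 + Var P45 * Var F34 * Var E4,
   Var P14 * Var F13 * Var E1 - Var P24 * Var F23 * Var E2 + Var P45 * Var F35 * Var E5,
   Var P12 * Var F13 * Var E1 - Var P24 * Var F34 * Var E4 + Var P25 * Var F35 * Var E5,
   Var P12 * Var F23 * Var E2 - Var P14 * Var F34 * Var E4 + Var P15 * Var F35 * Var E5,

   Var P15 * Var F14 * Var E1 - Var P25 * Var F24 * Var E2 + Var P35 * Var F34 * Var E3,
   Var P13 * Var F14 * Var E1 - Var P23 * Var F24 * Var E2 + Var P35 * Var F45 * Var E5,
   Var P12 * Var F14 * Var E1 - Var P23 * Var F34 * Var E3 + Var P25 * Var F45 * Var E5,
   Var P12 * Var F24 * Var E2 - Var P13 * Var F34 * Var E3 + Var P15 * Var F45 * Var E5,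

   Var P14 * Var F15 * Var E1 - Var P24 * Var F25 * Var E2 + Var P34 * Var F35 * Var E3,
   Var P13 * Var F15 * Var E1 - Var P23 * Var F25 * Var E2 + Var P34 * Var F45 * Var E4,
   Var P12 * Var F15 * Var E1 - Var P23 * Var F35 * Var E3 + Var P24 * Var F45 * Var E4,
   Var P12 * Var F25 * Var E2 - Var P13 * Var F35 * Var E3 + Var P14 * Var F45 * Var E4}"

end

theory Submission
  imports Defs
begin

text \<open>The ring homomorphism \<open>cox_map\<close> sends the \<open>p\<^sub>i\<^sub>j\<close> and, up to units, the \<open>F\<^sub>i\<^sub>j\<close> to the twenty \<open>3 \<times> 3\<close>
minors of the \<open>3 \<times> 6\<close> matrix \<open>(V, x)\<close>, that is, to the Pluecker coordinates of the affine cone over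
\<open>Gr(3,6)\<close>. Thirty of the trinomials are the three-term Pluecker relations of this Grassmannian. The
other fifteen express one and the same conic section \<open>G\<close> in fifteen ways, and these expressions
agree because of the Pluecker relations (\<open>conic_three_forms\<close>). So all trinomials lie in the kernel
(\<open>cox_map_trinomial_eq_0\<close>).

Conversely, the cone over \<open>Gr(3,6)\<close> has dimension 10, and on the open set \<open>[123] \<noteq> 0\<close> it has
coordinates \<open>[123]\<close> and the nine minors that share exactly two columns with \<open>[123]\<close>. Together with
\<open>E\<^sub>1, \<dots>, E\<^sub>5\<close> this makes 15 of the 26 variables free (\<open>free_vars\<close>). Each of the other 11 variables \<open>w\<close>
occurs in some trinomial \<open>u w - p\<close> in which \<open>u\<close> is a monomial in the free variables and \<open>p\<close> involves
only free variables and variables treated before \<open>w\<close>. Therefore every polynomial \<open>f\<close> satisfies \<open>u f \<equiv> g\<close>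
modulo the trinomials, where \<open>u\<close> is a monomial and \<open>g\<close> a polynomial in the free variables
(\<open>Var_clearable\<close>).

It remains to see that \<open>cox_map\<close> is injective on polynomials in the free variables. Specializing the
first three columns of \<open>V\<close> to a diagonal matrix turns the free minors into single entries of the
other columns up to a factor, so one can choose these entries in the Laurent polynomial ring of
the 26 variables in such a way that the image of each free variable specializes to that very
variable (\<open>chart_cox_image_free\<close>). The specialization is thus a left inverse. If \<open>f\<close> is in the kernel,
so is \<open>g\<close>; hence \<open>g = 0\<close>, and \<open>u f\<close>, and with it a power of the product of all variables times \<open>f\<close>, lies
in the ideal of the trinomials.\<close>

section \<open>Homomorphisms out of monoid rings\<close>

locale unital_ring_hom =
  fixes h :: "'a::comm_ring_1 \<Rightarrow> 'b::comm_ring_1"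
  assumes hom_one [simp]: "h 1 = 1"
    and hom_add [simp]: "h (x + y) = h x + h y"
    and hom_mult [simp]: "h (x * y) = h x * h y"
begin

lemma hom_zero [simp]: "h 0 = 0"
  using hom_add[of 0 0] by simp

lemma hom_uminus [simp]: "h (- x) = - h x"
  using hom_add[of "- x" x] by (simp add: eq_neg_iff_add_eq_0)

lemma hom_diff [simp]: "h (x - y) = h x - h y"
  using hom_add[of x "- y"] by simp

end

text \<open>The common form of all evaluation maps below: the substitution in polynomials, the embedding
of polynomials into Laurent polynomials, and the specialization of Laurent polynomials differ only
in the coefficient map \<open>c\<close> and in the values \<open>\<phi>\<close> of the monomials.\<close>

definition monoid_ring_extension ::
    "('a::comm_ring_1 \<Rightarrow> 'b::comm_ring_1) \<Rightarrow> ('m::comm_monoid_add \<Rightarrow> 'b) \<Rightarrow> ('m \<Rightarrow>\<^sub>0 'a) \<Rightarrow> 'b"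
  where "monoid_ring_extension c \<phi> f =
    (\<Sum>m\<in>Poly_Mapping.keys f. c (Poly_Mapping.lookup f m) * \<phi> m)"

lemma poly_mapping_sum_single:
  "(\<Sum>m\<in>Poly_Mapping.keys f. Poly_Mapping.single m (Poly_Mapping.lookup f m)) = f"
proof (rule poly_mapping_eqI)
  fix k
  show "Poly_Mapping.lookup (\<Sum>m\<in>Poly_Mapping.keys f.
      Poly_Mapping.single m (Poly_Mapping.lookup f m)) k = Poly_Mapping.lookup f k"
    by (simp add: lookup_sum lookup_single when_def in_keys_iff)
qed

context unital_ring_hom
begin

text \<open>Allowing any finite set that contains the support makes sums over different supports
comparable; additivity rests on this.\<close>

lemma monoid_ring_extension_superset:
  assumes "finite M" "Poly_Mapping.keys f \<subseteq> M"
  shows "monoid_ring_extension h \<phi> f = (\<Sum>m\<in>M. h (Poly_Mapping.lookup f m) * \<phi> m)"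
  unfolding monoid_ring_extension_def
  using assms by (intro sum.mono_neutral_left) (auto simp: in_keys_iff)

lemma monoid_ring_extension_single:
  "monoid_ring_extension h \<phi> (Poly_Mapping.single m a) = h a * \<phi> m"
  by (subst monoid_ring_extension_superset[of "{m}"]) auto

lemma monoid_ring_extension_add:
  "monoid_ring_extension h \<phi> (f + g) =
    monoid_ring_extension h \<phi> f + monoid_ring_extension h \<phi> g"
proof -
  let ?M = "Poly_Mapping.keys f \<union> Poly_Mapping.keys g"
  have "Poly_Mapping.keys (f + g) \<subseteq> ?M"
    by (rule keys_add)
  then show ?thesis
    by (simp add: monoid_ring_extension_superset[of ?M] lookup_add distrib_right sum.distrib)
qed

lemma monoid_ring_extension_sum:
  "monoid_ring_extension h \<phi> (sum F A) = (\<Sum>x\<in>A. monoid_ring_extension h \<phi> (F x))"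
  by (induction A rule: infinite_finite_induct)
    (simp_all add: monoid_ring_extension_add monoid_ring_extension_superset[of "{}"])

lemma unital_ring_hom_monoid_ring_extension:
  assumes zero: "\<phi> 0 = 1" and add: "\<And>m n. \<phi> (m + n) = \<phi> m * \<phi> n"
  shows "unital_ring_hom (monoid_ring_extension h \<phi>)"
proof
  show "monoid_ring_extension h \<phi> 1 = 1"
    using monoid_ring_extension_single[of \<phi> 0 1] by (simp add: zero)
next
  fix f g
  let ?e = "monoid_ring_extension h \<phi>"
  let ?s = "\<lambda>f m. Poly_Mapping.single m (Poly_Mapping.lookup f m)"
  have "?e (f * g) = ?e (sum (?s f) (Poly_Mapping.keys f) * sum (?s g) (Poly_Mapping.keys g))"
    by (simp only: poly_mapping_sum_single)
  also have "\<dots> = ?e (sum (?s f) (Poly_Mapping.keys f)) * ?e (sum (?s g) (Poly_Mapping.keys g))"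
    by (simp add: sum_product monoid_ring_extension_sum mult_single
        monoid_ring_extension_single add mult_ac)
  finally show "?e (f * g) = ?e f * ?e g"
    by (simp only: poly_mapping_sum_single)
qed (rule monoid_ring_extension_add)

end

interpretation const: unital_ring_hom "const :: 'a::comm_ring_1 \<Rightarrow> ('m::comm_monoid_add \<Rightarrow>\<^sub>0 'a)"
  by standard (simp_all add: const_def single_add mult_single)

text \<open>This transfers the homomorphism property to \<open>poly_subst\<close>; what remains is that evaluated
monomials multiply, again after enlarging the supports.\<close>

lemma poly_subst_eq_monoid_ring_extension:
  "poly_subst c g = monoid_ring_extension c
    (\<lambda>m. \<Prod>v\<in>Poly_Mapping.keys m. g v ^ Poly_Mapping.lookup m v)"
  by (rule ext) (simp add: poly_subst_def monoid_ring_extension_def)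

lemma prod_keys_power_add:
  fixes g :: "'v \<Rightarrow> 'b::comm_ring_1"
  shows "(\<Prod>v\<in>Poly_Mapping.keys (m + n). g v ^ Poly_Mapping.lookup (m + n) v) =
    (\<Prod>v\<in>Poly_Mapping.keys m. g v ^ Poly_Mapping.lookup m v) *
    (\<Prod>v\<in>Poly_Mapping.keys n. g v ^ Poly_Mapping.lookup n v)"
proof -
  let ?K = "Poly_Mapping.keys m \<union> Poly_Mapping.keys n"
  have superset: "(\<Prod>v\<in>Poly_Mapping.keys k. g v ^ Poly_Mapping.lookup k v) =
      (\<Prod>v\<in>?K. g v ^ Poly_Mapping.lookup k v)" if "Poly_Mapping.keys k \<subseteq> ?K" for k :: "'v \<Rightarrow>\<^sub>0 nat"
    using that by (intro prod.mono_neutral_left) (auto simp: in_keys_iff)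
  show ?thesis
    unfolding superset[OF keys_add] superset[OF Un_upper1] superset[OF Un_upper2]
    by (simp add: lookup_add power_add prod.distrib)
qed

context unital_ring_hom
begin

lemma unital_ring_hom_poly_subst: "unital_ring_hom (poly_subst h g)"
  unfolding poly_subst_eq_monoid_ring_extension
  by (rule unital_ring_hom_monoid_ring_extension) (simp_all add: prod_keys_power_add)

lemma poly_subst_Var [simp]: "poly_subst h g (Var v) = g v"
  by (simp add: Var_def poly_subst_eq_monoid_ring_extension monoid_ring_extension_single)

lemma poly_subst_const [simp]: "poly_subst h g (const a) = h a"
  by (simp add: const_def poly_subst_eq_monoid_ring_extension monoid_ring_extension_single)

end

text \<open>A polynomial is the sum of its terms, written with constants, variables, sums and products
only. This yields the induction principle that follows.\<close>

lemma poly_subst_Var_id: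
  fixes f :: "('v, 'a::comm_ring_1) mpoly"
  shows "poly_subst const Var f = f"
proof -
  have monomial: "(\<Prod>v\<in>Poly_Mapping.keys m. Var v ^ Poly_Mapping.lookup m v) =
      (Poly_Mapping.single m 1 :: ('v, 'a) mpoly)" for m :: "'v \<Rightarrow>\<^sub>0 nat"
  proof -
    have power: "(Var v :: ('v, 'a) mpoly) ^ n =
        Poly_Mapping.single (Poly_Mapping.single v n) 1" for v n
      by (induction n) (simp_all add: Var_def mult_single flip: single_add)
    have prod: "(\<Prod>v\<in>K. Poly_Mapping.single (e v) 1) =
        (Poly_Mapping.single (sum e K) 1 :: ('v, 'a) mpoly)" for e and K :: "'v set"
      by (induction K rule: infinite_finite_induct) (simp_all add: mult_single)
    show ?thesis
      by (simp only: power prod poly_mapping_sum_single)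
  qed
  show ?thesis
    unfolding poly_subst_def monomial
    by (simp add: const_def mult_single poly_mapping_sum_single)
qed

lemma mpoly_closed_induct:
  assumes const: "\<And>a. const a \<in> S" and Var: "\<And>v. Var v \<in> S"
    and add: "\<And>f g. f \<in> S \<Longrightarrow> g \<in> S \<Longrightarrow> f + g \<in> S"
    and mult: "\<And>f g. f \<in> S \<Longrightarrow> g \<in> S \<Longrightarrow> f * g \<in> S"
  shows "(f :: ('v, 'a::comm_ring_1) mpoly) \<in> S"
proof -
  have zero: "0 \<in> S" and one: "1 \<in> S"
    using const[of 0] const[of 1] by simp_all
  have power: "g ^ n \<in> S" if "g \<in> S" for g n
    using that by (induction n) (auto intro: mult one)
  have prod: "(\<Prod>v\<in>K. g v) \<in> S" if "\<And>v. g v \<in> S" for K :: "'v set" and g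
    using that by (induction K rule: infinite_finite_induct) (auto intro: mult one)
  have sum: "(\<Sum>m\<in>M. g m) \<in> S" if "\<And>m. g m \<in> S" for M :: "('v \<Rightarrow>\<^sub>0 nat) set" and g
    using that by (induction M rule: infinite_finite_induct) (auto intro: add zero)
  have "poly_subst const Var f \<in> S"
    unfolding poly_subst_def by (intro sum mult const prod power Var)
  then show ?thesis
    by (simp only: poly_subst_Var_id)
qed

section \<open>Laurent polynomials\<close>

definition monomial :: "'v \<Rightarrow> int \<Rightarrow> ('v, 'a::comm_ring_1) laurent"
  where "monomial v e = Poly_Mapping.single (Poly_Mapping.single v e) 1"

lemma monomial_cancel:
  "monomial v 1 * monomial v (- 1) = (1 :: ('v, 'a::comm_ring_1) laurent)"
  "monomial v (- 1) * monomial v 1 = (1 :: ('v, 'a::comm_ring_1) laurent)"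
  "monomial v 1 * (monomial v (- 1) * f) = (f :: ('v, 'a::comm_ring_1) laurent)"
  "monomial v (- 1) * (monomial v 1 * f) = (f :: ('v, 'a::comm_ring_1) laurent)"
  by (simp_all add: monomial_def mult_single flip: single_add mult.assoc)

text \<open>The condition \<open>v \<noteq> w\<close> restricts the use as a rewrite rule: factors are moved past each other
until powers of the same variable meet, where \<open>monomial_cancel\<close> must apply instead.\<close>

lemma monomial_commute:
  assumes "v \<noteq> w"
  shows "monomial v d * monomial w e =
      (monomial w e * monomial v d :: ('v, 'a::comm_ring_1) laurent)"
    and "monomial v d * (monomial w e * f) =
      (monomial w e * (monomial v d * f) :: ('v, 'a::comm_ring_1) laurent)"
  by (simp_all add: mult_ac)

definition laurent_embedding :: "('v, 'a::comm_ring_1) mpoly \<Rightarrow> ('v, 'a) laurent"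
  where "laurent_embedding =
    monoid_ring_extension const (\<lambda>m. Poly_Mapping.single (Poly_Mapping.map int m) 1)"

lemma lookup_map_int: "Poly_Mapping.lookup (Poly_Mapping.map int m) v = int (Poly_Mapping.lookup m v)"
  by (simp add: map.rep_eq when_def)

lemma map_int_add: "Poly_Mapping.map int (m + n) = Poly_Mapping.map int m + Poly_Mapping.map int n"
  by (rule poly_mapping_eqI) (simp add: lookup_map_int lookup_add)

lemma map_int_0 [simp]: "Poly_Mapping.map int 0 = 0"
  by (rule poly_mapping_eqI) (simp add: lookup_map_int)

lemma map_int_inject: "Poly_Mapping.map int m = Poly_Mapping.map int n \<longleftrightarrow> m = n"
  by (metis lookup_map_int of_nat_eq_iff poly_mapping_eqI)

interpretation laurent_embedding:
  unital_ring_hom "laurent_embedding :: ('v, 'a::comm_ring_1) mpoly \<Rightarrow> ('v, 'a) laurent"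
  unfolding laurent_embedding_def
  by (rule const.unital_ring_hom_monoid_ring_extension)
    (simp_all add: map_int_add mult_single)

lemma laurent_embedding_Var [simp]: "laurent_embedding (Var v) = monomial v 1"
  by (simp add: laurent_embedding_def Var_def const.monoid_ring_extension_single monomial_def)

lemma laurent_embedding_const [simp]: "laurent_embedding (const a) = const a"
  unfolding laurent_embedding_def const_def[of a] const.monoid_ring_extension_single
  by (simp add: const_def)

text \<open>Distinct monomials stay distinct under the embedding, so the coefficients can be read off;
this gives injectivity.\<close>

lemma lookup_laurent_embedding:
  "Poly_Mapping.lookup (laurent_embedding f) (Poly_Mapping.map int m) = Poly_Mapping.lookup f m"
  by (simp add: laurent_embedding_def monoid_ring_extension_def const_def mult_single lookup_sum
      lookup_single map_int_inject when_def in_keys_iff)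

lemma laurent_embedding_eq_0_iff [simp]: "laurent_embedding f = 0 \<longleftrightarrow> f = 0"
proof
  assume "laurent_embedding f = 0"
  then show "f = 0"
    by (intro poly_mapping_eqI) (metis lookup_laurent_embedding lookup_zero)
qed simp

section \<open>Pluecker relations and the kernel\<close>

text \<open>Five vectors in 3-space satisfy five relations of this kind, one for each choice of the
vector common to all determinants. The vectors are listed in a fixed order inside each
determinant; in this form the signs are those of the trinomials.\<close>

lemma three_term_pluecker:
  fixes a b c d e :: "'a::comm_ring_1 ^ 3"
  shows "det_columns a b c * det_columns a d e - det_columns a b d * det_columns a c e
      + det_columns a b e * det_columns a c d = 0"
    and "det_columns a b c * det_columns b d e - det_columns a b d * det_columns b c e
      + det_columns a b e * det_columns b c d = 0"
    and "det_columns a b c * det_columns c d e - det_columns a c d * det_columns b c e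
      + det_columns a c e * det_columns b c d = 0"
    and "det_columns a b d * det_columns c d e - det_columns a c d * det_columns b d e
      + det_columns a d e * det_columns b c d = 0"
    and "det_columns a b e * det_columns c d e - det_columns a c e * det_columns b d e
      + det_columns a d e * det_columns b c e = 0"
  unfolding det_columns_def det_3
  by (simp_all add: transpose_def vector_3 algebra_simps)

interpretation cox_map: unital_ring_hom "cox_map :: 'k::field cox_poly \<Rightarrow> 'k target"
  unfolding cox_map_def
proof (rule unital_ring_hom.unital_ring_hom_poly_subst)
  show "unital_ring_hom (\<lambda>a. const (const a) :: 'k target)"
    by standard simp_all
qed

lemma cox_map_Var [simp]: "cox_map (Var v) = (cox_image v :: 'k::field target)"
proof -
  interpret c: unital_ring_hom "\<lambda>a::'k. const (const a) :: 'k target"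
    by standard simp_all
  show ?thesis
    by (simp add: cox_map_def)
qed

lemma cox_map_const [simp]: "cox_map (const a) = (const (const a) :: 'k::field target)"
proof -
  interpret c: unital_ring_hom "\<lambda>a::'k. const (const a) :: 'k target"
    by standard simp_all
  show ?thesis
    by (simp add: cox_map_def)
qed

lemma t_power_eq_monomial: "t_power = monomial"
  by (simp add: fun_eq_iff t_power_def monomial_def)

text \<open>Both \<open>(p, -q, r)\<close> and \<open>(l, -m, n)\<close> are orthogonal to \<open>(1, 1, 1)\<close>, hence their cross product is a
multiple of \<open>(1, 1, 1)\<close>: its coordinates agree. With \<open>p, q, r\<close> the products of two \<open>p\<^sub>i\<^sub>j\<close> in a base
relation and \<open>l, m, n\<close> the corresponding products of two \<open>F\<^sub>i\<^sub>j\<close>, these coordinates are the three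
expressions for \<open>G E\<^sub>i\<close> in one group.\<close>

lemma conic_three_forms:
  fixes p q r l m n :: "'a::comm_ring_1"
  assumes "p - q + r = 0" "l - m + n = 0"
  shows "p * n - r * l = p * m - q * l" "q * n - r * m = p * m - q * l"
proof -
  have "p * n - r * l - (p * m - q * l) = p * (l - m + n) - l * (p - q + r)"
    "q * n - r * m - (p * m - q * l) = q * (l - m + n) - m * (p - q + r)"
    by (simp_all add: algebra_simps)
  then show "p * n - r * l = p * m - q * l" "q * n - r * m = p * m - q * l"
    using assms by simp_all
qed

text \<open>That two polynomials agree modulo the Pluecker relations is certified by explicit cofactors
\<open>a\<close> and \<open>a'\<close>; each comparison of two expressions for the conic takes two relations.\<close>

lemma eq_by_combination:
  fixes f :: "'a::comm_ring_1"
  assumes "r = 0" "r' = 0" "f - f' = a * r + a' * r'"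
  shows "f = f'"
  using assms by simp

lemma eq_0_by_factor: "c = 0 \<Longrightarrow> f = c * w \<Longrightarrow> f = (0 :: 'a::comm_ring_1)"
  by simp

text \<open>Up to a monomial in the \<open>t\<^sub>i\<close>, each trinomial becomes a three-term Pluecker relation among the
points and \<open>x\<close>, or one of the fifteen expressions for the conic.\<close>

lemma cox_map_trinomial_eq_0:
  assumes "f \<in> (trinomials :: 'k::field cox_poly set)"
  shows "cox_map f = 0"
proof -
  let ?v = "\<lambda>i. column i (V_matrix :: 'k vx_poly ^ 5 ^ 3)"
  note push = bracket_def[symmetric] ell_def[symmetric]
    const.hom_add const.hom_diff const.hom_mult const.hom_zero
  \<comment> \<open>The six choices of five vectors among \<open>v\<^sub>1, \<dots>, v\<^sub>5, x\<close>; the index of a relation below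
    is the position of the common vector.\<close>
  note pl12345 = three_term_pluecker[
      where a="?v 1" and b="?v 2" and c="?v 3" and d="?v 4" and e="?v 5",
      THEN arg_cong[where f = "const :: 'k vx_poly \<Rightarrow> 'k target"], unfolded push]
  note pl1234x = three_term_pluecker[
      where a="?v 1" and b="?v 2" and c="?v 3" and d="?v 4" and e="x_vector",
      THEN arg_cong[where f = "const :: 'k vx_poly \<Rightarrow> 'k target"], unfolded push]
  note pl1235x = three_term_pluecker[
      where a="?v 1" and b="?v 2" and c="?v 3" and d="?v 5" and e="x_vector",
      THEN arg_cong[where f = "const :: 'k vx_poly \<Rightarrow> 'k target"], unfolded push]
  note pl1245x = three_term_pluecker[
      where a="?v 1" and b="?v 2" and c="?v 4" and d="?v 5" and e="x_vector",
      THEN arg_cong[where f = "const :: 'k vx_poly \<Rightarrow> 'k target"], unfolded push]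
  note pl1345x = three_term_pluecker[
      where a="?v 1" and b="?v 3" and c="?v 4" and d="?v 5" and e="x_vector",
      THEN arg_cong[where f = "const :: 'k vx_poly \<Rightarrow> 'k target"], unfolded push]
  note pl2345x = three_term_pluecker[
      where a="?v 2" and b="?v 3" and c="?v 4" and d="?v 5" and e="x_vector",
      THEN arg_cong[where f = "const :: 'k vx_poly \<Rightarrow> 'k target"], unfolded push]
  let ?p12 = "const (bracket 3 4 5) :: 'k target"
  let ?p13 = "const (bracket 2 4 5) :: 'k target"
  let ?p14 = "const (bracket 2 3 5) :: 'k target"
  let ?p15 = "const (bracket 2 3 4) :: 'k target"
  let ?p23 = "const (bracket 1 4 5) :: 'k target"
  let ?p24 = "const (bracket 1 3 5) :: 'k target"
  let ?p25 = "const (bracket 1 3 4) :: 'k target"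
  let ?p34 = "const (bracket 1 2 5) :: 'k target"
  let ?p35 = "const (bracket 1 2 4) :: 'k target"
  let ?p45 = "const (bracket 1 2 3) :: 'k target"
  let ?l12 = "const (ell 1 2) :: 'k target"
  let ?l13 = "const (ell 1 3) :: 'k target"
  let ?l14 = "const (ell 1 4) :: 'k target"
  let ?l15 = "const (ell 1 5) :: 'k target"
  let ?l23 = "const (ell 2 3) :: 'k target"
  let ?l24 = "const (ell 2 4) :: 'k target"
  let ?l25 = "const (ell 2 5) :: 'k target"
  let ?l34 = "const (ell 3 4) :: 'k target"
  let ?l35 = "const (ell 3 5) :: 'k target"
  let ?l45 = "const (ell 4 5) :: 'k target"
  \<comment> \<open>\<open>?p\<^sub>i\<^sub>j\<close> and \<open>?l\<^sub>i\<^sub>j\<close> are the images of \<open>p\<^sub>i\<^sub>j\<close> and \<open>F\<^sub>i\<^sub>j\<close>, the latter without the units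
    \<open>t\<^sub>i\<close>, and \<open>?g\<close> is the image of \<open>G\<close> without them.\<close>
  let ?g = "const (bracket 1 2 3 * bracket 1 4 5 * ell 2 4 * ell 3 5
    - bracket 1 2 4 * bracket 1 3 5 * ell 2 3 * ell 4 5) :: 'k target"
  have r1: "?p23 * ?p45 - ?p24 * ?p35 + ?p25 * ?p34 = 0"
    using pl12345(1) by (simp add: mult_ac)
  note three1 = conic_three_forms[OF r1 pl2345x(5)]
  \<comment> \<open>The conic is given by the first expression of the first group.\<close>
  have c1: "(?p23 * ?p45) * (?l24 * ?l35) - (?p24 * ?p35) * (?l23 * ?l45) = ?g"
    by (simp add: algebra_simps)
  note c1 = c1 three1(1)[unfolded c1] three1(2)[unfolded c1]
  \<comment> \<open>For \<open>i \<ge> 2\<close> the first expression of group \<open>i\<close> is compared with an expression of the first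
    group that shares with it, in each of its two terms, a factor \<open>p\<^sub>j\<^sub>k l\<^sub>m\<^sub>n\<close>; this factor is the
    cofactor of a Pluecker relation between the remaining factors.\<close>
  have r2: "?p13 * ?p45 - ?p14 * ?p35 + ?p15 * ?p34 = 0"
    using pl12345(2) by (simp add: mult_ac)
  note three2 = conic_three_forms[OF r2 pl1345x(5)]
  have "(?p13 * ?p45) * (?l14 * ?l35) - (?p14 * ?p35) * (?l13 * ?l45)
      = (?p23 * ?p45) * (?l24 * ?l35) - (?p24 * ?p35) * (?l23 * ?l45)"
    by (rule eq_by_combination[OF pl1235x(3) pl1245x(3),
          where a = "- ?p35 * ?l45" and a' = "?p45 * ?l35"])
      (simp add: algebra_simps)
  then have c2: "(?p13 * ?p45) * (?l14 * ?l35) - (?p14 * ?p35) * (?l13 * ?l45) = ?g"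
    using c1 three1 by simp
  note c2 = c2 three2(1)[unfolded c2] three2(2)[unfolded c2]
  have r3: "?p12 * ?p45 - ?p14 * ?p25 + ?p15 * ?p24 = 0"
    using pl12345(3) by (simp add: mult_ac)
  note three3 = conic_three_forms[OF r3 pl1245x(5)]
  have "(?p12 * ?p45) * (?l14 * ?l25) - (?p14 * ?p25) * (?l12 * ?l45)
      = (?p23 * ?p45) * (?l25 * ?l34) - (?p25 * ?p34) * (?l23 * ?l45)"
    by (rule eq_by_combination[OF pl1235x(2) pl1345x(3),
          where a = "- ?p25 * ?l45" and a' = "?p45 * ?l25"])
      (simp add: algebra_simps)
  then have c3: "(?p12 * ?p45) * (?l14 * ?l25) - (?p14 * ?p25) * (?l12 * ?l45) = ?g"
    using c1 three1 by simp
  note c3 = c3 three3(1)[unfolded c3] three3(2)[unfolded c3]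
  have r4: "?p12 * ?p35 - ?p13 * ?p25 + ?p15 * ?p23 = 0"
    using pl12345(4) by (simp add: mult_ac)
  note three4 = conic_three_forms[OF r4 pl1235x(5)]
  have "(?p12 * ?p35) * (?l13 * ?l25) - (?p13 * ?p25) * (?l12 * ?l35)
      = (?p24 * ?p35) * (?l25 * ?l34) - (?p25 * ?p34) * (?l24 * ?l35)"
    by (rule eq_by_combination[OF pl1245x(2) pl1345x(2),
          where a = "- ?p25 * ?l35" and a' = "?p35 * ?l25"])
      (simp add: algebra_simps)
  then have c4: "(?p12 * ?p35) * (?l13 * ?l25) - (?p13 * ?p25) * (?l12 * ?l35) = ?g"
    using c1 three1 by simp
  note c4 = c4 three4(1)[unfolded c4] three4(2)[unfolded c4]
  have r5: "?p12 * ?p34 - ?p13 * ?p24 + ?p14 * ?p23 = 0"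
    using pl12345(5) by (simp add: mult_ac)
  note three5 = conic_three_forms[OF r5 pl1234x(5)]
  have "(?p12 * ?p34) * (?l13 * ?l24) - (?p13 * ?p24) * (?l12 * ?l34)
      = (?p24 * ?p35) * (?l25 * ?l34) - (?p25 * ?p34) * (?l24 * ?l35)"
    by (rule eq_by_combination[OF pl1245x(2) pl1345x(2),
          where a = "- ?p24 * ?l34" and a' = "?p34 * ?l24"])
      (simp add: algebra_simps)
  then have c5: "(?p12 * ?p34) * (?l13 * ?l24) - (?p13 * ?p24) * (?l12 * ?l34) = ?g"
    using c1 three1 by simp
  note c5 = c5 three5(1)[unfolded c5] three5(2)[unfolded c5]
  note image = cox_map.hom_add cox_map.hom_diff cox_map.hom_mult cox_map_Var cox_image.simps
  \<comment> \<open>Positive powers of the \<open>t\<^sub>i\<close> move to the left until they cancel.\<close>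
  note normalize = t_power_eq_monomial mult.assoc monomial_cancel
    monomial_commute[where d = "- 1" and e = 1]
  have base1: "cox_map (Var P12 * Var P34 - Var P13 * Var P24 + Var P14 * Var P23) = (0 :: 'k target)"
    using r5 by (simp add: mult_ac)
  have base2: "cox_map (Var P12 * Var P35 - Var P13 * Var P25 + Var P15 * Var P23) = (0 :: 'k target)"
    using r4 by (simp add: mult_ac)
  have base3: "cox_map (Var P12 * Var P45 - Var P14 * Var P25 + Var P15 * Var P24) = (0 :: 'k target)"
    using r3 by (simp add: mult_ac)
  have base4: "cox_map (Var P13 * Var P45 - Var P14 * Var P35 + Var P15 * Var P34) = (0 :: 'k target)"
    using r2 by (simp add: mult_ac)
  have base5: "cox_map (Var P23 * Var P45 - Var P24 * Var P35 + Var P25 * Var P34) = (0 :: 'k target)"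
    using r1 by (simp add: mult_ac)
  \<comment> \<open>Each image below is its Pluecker or conic relation times a monomial in the \<open>t\<^sub>j\<close>: for \<open>lines\<close>
    and \<open>conic\<close> of group \<open>i\<close> this is \<open>?w\<^sub>i\<close>, the product of the inverses of all \<open>t\<^sub>j\<close> with \<open>j \<noteq> i\<close>;
    for \<open>pencil\<close>, which relates the three lines \<open>F\<^sub>i\<^sub>j\<close> through point \<open>i\<close>, it is the inverse of \<open>t\<^sub>i\<close>.\<close>
  let ?w1 = "t_power 2 (- 1) * t_power 3 (- 1) * t_power 4 (- 1) * t_power 5 (- 1) :: 'k target"
  let ?w2 = "t_power 1 (- 1) * t_power 3 (- 1) * t_power 4 (- 1) * t_power 5 (- 1) :: 'k target"
  let ?w3 = "t_power 1 (- 1) * t_power 2 (- 1) * t_power 4 (- 1) * t_power 5 (- 1) :: 'k target"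
  let ?w4 = "t_power 1 (- 1) * t_power 2 (- 1) * t_power 3 (- 1) * t_power 5 (- 1) :: 'k target"
  let ?w5 = "t_power 1 (- 1) * t_power 2 (- 1) * t_power 3 (- 1) * t_power 4 (- 1) :: 'k target"
  have lines1: "cox_map (Var F23 * Var F45 - Var F24 * Var F35 + Var F25 * Var F34) = (0 :: 'k target)"
    by (rule eq_0_by_factor[OF pl2345x(5), where w = ?w1])
      (simp add: image normalize; simp add: algebra_simps)
  have conic1_1: "cox_map (Var P23 * Var P45 * Var F24 * Var F35
      - Var P24 * Var P35 * Var F23 * Var F45
      - Var G * Var E1) = (0 :: 'k target)"
    by (rule eq_0_by_factor[OF iffD2[OF right_minus_eq c1(1)], where w = ?w1])
      (simp add: image normalize; simp add: algebra_simps)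
  have conic1_2: "cox_map (Var P23 * Var P45 * Var F25 * Var F34
      - Var P25 * Var P34 * Var F23 * Var F45
      - Var G * Var E1) = (0 :: 'k target)"
    by (rule eq_0_by_factor[OF iffD2[OF right_minus_eq c1(2)], where w = ?w1])
      (simp add: image normalize; simp add: algebra_simps)
  have conic1_3: "cox_map (Var P24 * Var P35 * Var F25 * Var F34
      - Var P25 * Var P34 * Var F24 * Var F35
      - Var G * Var E1) = (0 :: 'k target)"
    by (rule eq_0_by_factor[OF iffD2[OF right_minus_eq c1(3)], where w = ?w1])
      (simp add: image normalize; simp add: algebra_simps)
  have lines2: "cox_map (Var F13 * Var F45 - Var F14 * Var F35 + Var F15 * Var F34) = (0 :: 'k target)"
    by (rule eq_0_by_factor[OF pl1345x(5), where w = ?w2])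
      (simp add: image normalize; simp add: algebra_simps)
  have conic2_1: "cox_map (Var P13 * Var P45 * Var F14 * Var F35
      - Var P14 * Var P35 * Var F13 * Var F45
      - Var G * Var E2) = (0 :: 'k target)"
    by (rule eq_0_by_factor[OF iffD2[OF right_minus_eq c2(1)], where w = ?w2])
      (simp add: image normalize; simp add: algebra_simps)
  have conic2_2: "cox_map (Var P13 * Var P45 * Var F15 * Var F34
      - Var P15 * Var P34 * Var F13 * Var F45
      - Var G * Var E2) = (0 :: 'k target)"
    by (rule eq_0_by_factor[OF iffD2[OF right_minus_eq c2(2)], where w = ?w2])
      (simp add: image normalize; simp add: algebra_simps)
  have conic2_3: "cox_map (Var P14 * Var P35 * Var F15 * Var F34
      - Var P15 * Var P34 * Var F14 * Var F35
      - Var G * Var E2) = (0 :: 'k target)"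
    by (rule eq_0_by_factor[OF iffD2[OF right_minus_eq c2(3)], where w = ?w2])
      (simp add: image normalize; simp add: algebra_simps)
  have lines3: "cox_map (Var F12 * Var F45 - Var F14 * Var F25 + Var F15 * Var F24) = (0 :: 'k target)"
    by (rule eq_0_by_factor[OF pl1245x(5), where w = ?w3])
      (simp add: image normalize; simp add: algebra_simps)
  have conic3_1: "cox_map (Var P12 * Var P45 * Var F14 * Var F25
      - Var P14 * Var P25 * Var F12 * Var F45
      - Var G * Var E3) = (0 :: 'k target)"
    by (rule eq_0_by_factor[OF iffD2[OF right_minus_eq c3(1)], where w = ?w3])
      (simp add: image normalize; simp add: algebra_simps)
  have conic3_2: "cox_map (Var P12 * Var P45 * Var F15 * Var F24
      - Var P15 * Var P24 * Var F12 * Var F45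
      - Var G * Var E3) = (0 :: 'k target)"
    by (rule eq_0_by_factor[OF iffD2[OF right_minus_eq c3(2)], where w = ?w3])
      (simp add: image normalize; simp add: algebra_simps)
  have conic3_3: "cox_map (Var P14 * Var P25 * Var F15 * Var F24
      - Var P15 * Var P24 * Var F14 * Var F25
      - Var G * Var E3) = (0 :: 'k target)"
    by (rule eq_0_by_factor[OF iffD2[OF right_minus_eq c3(3)], where w = ?w3])
      (simp add: image normalize; simp add: algebra_simps)
  have lines4: "cox_map (Var F12 * Var F35 - Var F13 * Var F25 + Var F15 * Var F23) = (0 :: 'k target)"
    by (rule eq_0_by_factor[OF pl1235x(5), where w = ?w4])
      (simp add: image normalize; simp add: algebra_simps)
  have conic4_1: "cox_map (Var P12 * Var P35 * Var F13 * Var F25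
      - Var P13 * Var P25 * Var F12 * Var F35
      - Var G * Var E4) = (0 :: 'k target)"
    by (rule eq_0_by_factor[OF iffD2[OF right_minus_eq c4(1)], where w = ?w4])
      (simp add: image normalize; simp add: algebra_simps)
  have conic4_2: "cox_map (Var P12 * Var P35 * Var F15 * Var F23
      - Var P15 * Var P23 * Var F12 * Var F35
      - Var G * Var E4) = (0 :: 'k target)"
    by (rule eq_0_by_factor[OF iffD2[OF right_minus_eq c4(2)], where w = ?w4])
      (simp add: image normalize; simp add: algebra_simps)
  have conic4_3: "cox_map (Var P13 * Var P25 * Var F15 * Var F23
      - Var P15 * Var P23 * Var F13 * Var F25
      - Var G * Var E4) = (0 :: 'k target)"
    by (rule eq_0_by_factor[OF iffD2[OF right_minus_eq c4(3)], where w = ?w4])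
      (simp add: image normalize; simp add: algebra_simps)
  have lines5: "cox_map (Var F12 * Var F34 - Var F13 * Var F24 + Var F14 * Var F23) = (0 :: 'k target)"
    by (rule eq_0_by_factor[OF pl1234x(5), where w = ?w5])
      (simp add: image normalize; simp add: algebra_simps)
  have conic5_1: "cox_map (Var P12 * Var P34 * Var F13 * Var F24
      - Var P13 * Var P24 * Var F12 * Var F34
      - Var G * Var E5) = (0 :: 'k target)"
    by (rule eq_0_by_factor[OF iffD2[OF right_minus_eq c5(1)], where w = ?w5])
      (simp add: image normalize; simp add: algebra_simps)
  have conic5_2: "cox_map (Var P12 * Var P34 * Var F14 * Var F23
      - Var P14 * Var P23 * Var F12 * Var F34
      - Var G * Var E5) = (0 :: 'k target)"
    by (rule eq_0_by_factor[OF iffD2[OF right_minus_eq c5(2)], where w = ?w5])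
      (simp add: image normalize; simp add: algebra_simps)
  have conic5_3: "cox_map (Var P13 * Var P24 * Var F14 * Var F23
      - Var P14 * Var P23 * Var F13 * Var F24
      - Var G * Var E5) = (0 :: 'k target)"
    by (rule eq_0_by_factor[OF iffD2[OF right_minus_eq c5(3)], where w = ?w5])
      (simp add: image normalize; simp add: algebra_simps)
  have pencil1_1: "cox_map (Var P25 * Var F12 * Var E2 - Var P35 * Var F13 * Var E3
      + Var P45 * Var F14 * Var E4) = (0 :: 'k target)"
    by (rule eq_0_by_factor[OF pl1234x(1), where w = "t_power 1 (- 1)"])
      (simp add: image normalize; simp add: algebra_simps)
  have pencil1_2: "cox_map (Var P24 * Var F12 * Var E2 - Var P34 * Var F13 * Var E3
      + Var P45 * Var F15 * Var E5) = (0 :: 'k target)"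
    by (rule eq_0_by_factor[OF pl1235x(1), where w = "t_power 1 (- 1)"])
      (simp add: image normalize; simp add: algebra_simps)
  have pencil1_3: "cox_map (Var P23 * Var F12 * Var E2 - Var P34 * Var F14 * Var E4
      + Var P35 * Var F15 * Var E5) = (0 :: 'k target)"
    by (rule eq_0_by_factor[OF pl1245x(1), where w = "t_power 1 (- 1)"])
      (simp add: image normalize; simp add: algebra_simps)
  have pencil1_4: "cox_map (Var P23 * Var F13 * Var E3 - Var P24 * Var F14 * Var E4
      + Var P25 * Var F15 * Var E5) = (0 :: 'k target)"
    by (rule eq_0_by_factor[OF pl1345x(1), where w = "t_power 1 (- 1)"])
      (simp add: image normalize; simp add: algebra_simps)
  have pencil2_1: "cox_map (Var P15 * Var F12 * Var E1 - Var P35 * Var F23 * Var E3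
      + Var P45 * Var F24 * Var E4) = (0 :: 'k target)"
    by (rule eq_0_by_factor[OF pl1234x(2), where w = "t_power 2 (- 1)"])
      (simp add: image normalize; simp add: algebra_simps)
  have pencil2_2: "cox_map (Var P14 * Var F12 * Var E1 - Var P34 * Var F23 * Var E3
      + Var P45 * Var F25 * Var E5) = (0 :: 'k target)"
    by (rule eq_0_by_factor[OF pl1235x(2), where w = "t_power 2 (- 1)"])
      (simp add: image normalize; simp add: algebra_simps)
  have pencil2_3: "cox_map (Var P13 * Var F12 * Var E1 - Var P34 * Var F24 * Var E4
      + Var P35 * Var F25 * Var E5) = (0 :: 'k target)"
    by (rule eq_0_by_factor[OF pl1245x(2), where w = "t_power 2 (- 1)"])
      (simp add: image normalize; simp add: algebra_simps)
  have pencil2_4: "cox_map (Var P13 * Var F23 * Var E3 - Var P14 * Var F24 * Var E4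
      + Var P15 * Var F25 * Var E5) = (0 :: 'k target)"
    by (rule eq_0_by_factor[OF pl2345x(1), where w = "t_power 2 (- 1)"])
      (simp add: image normalize; simp add: algebra_simps)
  have pencil3_1: "cox_map (Var P15 * Var F13 * Var E1 - Var P25 * Var F23 * Var E2
      + Var P45 * Var F34 * Var E4) = (0 :: 'k target)"
    by (rule eq_0_by_factor[OF pl1234x(3), where w = "t_power 3 (- 1)"])
      (simp add: image normalize; simp add: algebra_simps)
  have pencil3_2: "cox_map (Var P14 * Var F13 * Var E1 - Var P24 * Var F23 * Var E2
      + Var P45 * Var F35 * Var E5) = (0 :: 'k target)"
    by (rule eq_0_by_factor[OF pl1235x(3), where w = "t_power 3 (- 1)"])
      (simp add: image normalize; simp add: algebra_simps)
  have pencil3_3: "cox_map (Var P12 * Var F13 * Var E1 - Var P24 * Var F34 * Var E4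
      + Var P25 * Var F35 * Var E5) = (0 :: 'k target)"
    by (rule eq_0_by_factor[OF pl1345x(2), where w = "t_power 3 (- 1)"])
      (simp add: image normalize; simp add: algebra_simps)
  have pencil3_4: "cox_map (Var P12 * Var F23 * Var E2 - Var P14 * Var F34 * Var E4
      + Var P15 * Var F35 * Var E5) = (0 :: 'k target)"
    by (rule eq_0_by_factor[OF pl2345x(2), where w = "t_power 3 (- 1)"])
      (simp add: image normalize; simp add: algebra_simps)
  have pencil4_1: "cox_map (Var P15 * Var F14 * Var E1 - Var P25 * Var F24 * Var E2
      + Var P35 * Var F34 * Var E3) = (0 :: 'k target)"
    by (rule eq_0_by_factor[OF pl1234x(4), where w = "t_power 4 (- 1)"])
      (simp add: image normalize; simp add: algebra_simps)
  have pencil4_2: "cox_map (Var P13 * Var F14 * Var E1 - Var P23 * Var F24 * Var E2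
      + Var P35 * Var F45 * Var E5) = (0 :: 'k target)"
    by (rule eq_0_by_factor[OF pl1245x(3), where w = "t_power 4 (- 1)"])
      (simp add: image normalize; simp add: algebra_simps)
  have pencil4_3: "cox_map (Var P12 * Var F14 * Var E1 - Var P23 * Var F34 * Var E3
      + Var P25 * Var F45 * Var E5) = (0 :: 'k target)"
    by (rule eq_0_by_factor[OF pl1345x(3), where w = "t_power 4 (- 1)"])
      (simp add: image normalize; simp add: algebra_simps)
  have pencil4_4: "cox_map (Var P12 * Var F24 * Var E2 - Var P13 * Var F34 * Var E3
      + Var P15 * Var F45 * Var E5) = (0 :: 'k target)"
    by (rule eq_0_by_factor[OF pl2345x(3), where w = "t_power 4 (- 1)"])
      (simp add: image normalize; simp add: algebra_simps)
  have pencil5_1: "cox_map (Var P14 * Var F15 * Var E1 - Var P24 * Var F25 * Var E2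
      + Var P34 * Var F35 * Var E3) = (0 :: 'k target)"
    by (rule eq_0_by_factor[OF pl1235x(4), where w = "t_power 5 (- 1)"])
      (simp add: image normalize; simp add: algebra_simps)
  have pencil5_2: "cox_map (Var P13 * Var F15 * Var E1 - Var P23 * Var F25 * Var E2
      + Var P34 * Var F45 * Var E4) = (0 :: 'k target)"
    by (rule eq_0_by_factor[OF pl1245x(4), where w = "t_power 5 (- 1)"])
      (simp add: image normalize; simp add: algebra_simps)
  have pencil5_3: "cox_map (Var P12 * Var F15 * Var E1 - Var P23 * Var F35 * Var E3
      + Var P24 * Var F45 * Var E4) = (0 :: 'k target)"
    by (rule eq_0_by_factor[OF pl1345x(4), where w = "t_power 5 (- 1)"])
      (simp add: image normalize; simp add: algebra_simps)
  have pencil5_4: "cox_map (Var P12 * Var F25 * Var E2 - Var P13 * Var F35 * Var E3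
      + Var P14 * Var F45 * Var E4) = (0 :: 'k target)"
    by (rule eq_0_by_factor[OF pl2345x(4), where w = "t_power 5 (- 1)"])
      (simp add: image normalize; simp add: algebra_simps)
  show ?thesis
    using assms unfolding trinomials_def
    by (elim insertE emptyE)
      (simp_all only: base1 base2 base3 base4 base5 lines1 conic1_1 conic1_2 conic1_3 lines2 conic2_1
        conic2_2 conic2_3 lines3 conic3_1 conic3_2 conic3_3 lines4 conic4_1 conic4_2
        conic4_3 lines5 conic5_1 conic5_2 conic5_3 pencil1_1 pencil1_2 pencil1_3
        pencil1_4 pencil2_1 pencil2_2 pencil2_3 pencil2_4 pencil3_1 pencil3_2 pencil3_3
        pencil3_4 pencil4_1 pencil4_2 pencil4_3 pencil4_4 pencil5_1 pencil5_2 pencil5_3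
        pencil5_4)
qed

section \<open>Clearing denominators modulo an ideal\<close>

text \<open>The abstract form of the elimination: \<open>A\<close> is a subring, \<open>U\<close> a multiplicative set of denominators
in it, and \<open>I\<close> an ideal. Once \<open>U\<close> is inverted, the clearable elements are those congruent modulo \<open>I\<close> to
a fraction with numerator in \<open>A\<close>. The condition is stated without fractions, since the denominators
may be zero divisors modulo \<open>I\<close>.\<close>

locale elimination =
  fixes U A I :: "'a::comm_ring_1 set"
  assumes U_subset: "U \<subseteq> A"
    and U_one: "1 \<in> U"
    and U_mult: "u \<in> U \<Longrightarrow> u' \<in> U \<Longrightarrow> u * u' \<in> U"
    and A_add: "f \<in> A \<Longrightarrow> g \<in> A \<Longrightarrow> f + g \<in> A"
    and A_mult: "f \<in> A \<Longrightarrow> g \<in> A \<Longrightarrow> f * g \<in> A"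
    and A_uminus: "f \<in> A \<Longrightarrow> - f \<in> A"
    and I_zero: "0 \<in> I"
    and I_add: "f \<in> I \<Longrightarrow> g \<in> I \<Longrightarrow> f + g \<in> I"
    and I_mult: "f \<in> I \<Longrightarrow> r * f \<in> I"
begin

definition clearable :: "'a set"
  where "clearable = {f. \<exists>u\<in>U. \<exists>g\<in>A. u * f - g \<in> I}"

lemma clearable_base: "f \<in> A \<Longrightarrow> f \<in> clearable"
  unfolding clearable_def using U_one I_zero by force

lemma clearable_add:
  assumes "f \<in> clearable" "f' \<in> clearable"
  shows "f + f' \<in> clearable"
proof -
  obtain u g u' g' where *: "u \<in> U" "g \<in> A" "u * f - g \<in> I" "u' \<in> U" "g' \<in> A" "u' * f' - g' \<in> I"
    using assms by (auto simp: clearable_def)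
  have "u' * (u * f - g) + u * (u' * f' - g') \<in> I"
    using * by (intro I_add I_mult)
  then have "u * u' * (f + f') - (u' * g + u * g') \<in> I"
    by (simp add: algebra_simps)
  moreover have "u' * g + u * g' \<in> A"
    using * U_subset by (auto intro!: A_add A_mult)
  ultimately show ?thesis
    unfolding clearable_def using * U_mult by blast
qed

text \<open>The clearable elements form a ring by the usual product of fractions: modulo \<open>I\<close>, the product
of \<open>u f \<equiv> g\<close> and \<open>u' f' \<equiv> g'\<close> is \<open>u u' f f' \<equiv> g g'\<close>.\<close>

lemma clearable_mult:
  assumes "f \<in> clearable" "f' \<in> clearable"
  shows "f * f' \<in> clearable"
proof -
  obtain u g u' g' where *: "u \<in> U" "g \<in> A" "u * f - g \<in> I" "u' \<in> U" "g' \<in> A" "u' * f' - g' \<in> I"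
    using assms by (auto simp: clearable_def)
  have "(u' * f') * (u * f - g) + g * (u' * f' - g') \<in> I"
    using * by (intro I_add I_mult)
  then have "u * u' * (f * f') - g * g' \<in> I"
    by (simp add: algebra_simps)
  then show ?thesis
    unfolding clearable_def using * U_mult A_mult by blast
qed

lemma clearable_uminus: "f \<in> clearable \<Longrightarrow> - f \<in> clearable"
proof -
  assume "f \<in> clearable"
  then obtain u g where *: "u \<in> U" "g \<in> A" "u * f - g \<in> I"
    by (auto simp: clearable_def)
  have "(- 1) * (u * f - g) \<in> I"
    using * by (intro I_mult)
  then have "u * (- f) - (- g) \<in> I"
    by (simp add: algebra_simps)
  then show ?thesis
    unfolding clearable_def using * A_uminus by blast
qed

lemma clearable_diff: "f \<in> clearable \<Longrightarrow> g \<in> clearable \<Longrightarrow> f - g \<in> clearable"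
  using clearable_add[of f "- g"] clearable_uminus by simp

text \<open>One step of the elimination: here \<open>f\<close> is a variable and \<open>u f - p\<close> a trinomial, solved for \<open>f\<close>
after division by \<open>u\<close>.\<close>

lemma clearable_step:
  assumes "u \<in> U" "u * f - p \<in> I" "p \<in> clearable"
  shows "f \<in> clearable"
proof -
  obtain u' g where *: "u' \<in> U" "g \<in> A" "u' * p - g \<in> I"
    using assms by (auto simp: clearable_def)
  have "u' * (u * f - p) + (u' * p - g) \<in> I"
    using assms * by (intro I_add I_mult)
  then have "u' * u * f - g \<in> I"
    by (simp add: algebra_simps)
  then show ?thesis
    unfolding clearable_def using * assms U_mult by blast
qed

end

lemma module_times: "module ((*) :: 'a::comm_ring_1 \<Rightarrow> 'a \<Rightarrow> 'a)"
  by unfold_locales (simp_all add: algebra_simps)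

section \<open>A monomial chart of the universal Cox ring\<close>

text \<open>The variable whose image is \<open>t\<^sub>i\<close>, and thus the one to which the chart must send \<open>t\<^sub>i\<close>.\<close>

definition exceptional :: "5 \<Rightarrow> cox_var"
  where "exceptional i = (if i = 1 then E1 else if i = 2 then E2 else if i = 3 then E3
    else if i = 4 then E4 else E5)"

text \<open>The first three columns of \<open>V\<close> become the diagonal matrix with entries \<open>p\<^sub>4\<^sub>5, 1, 1\<close>, so that
\<open>[123] = p\<^sub>4\<^sub>5\<close>. For any column \<open>y\<close> then \<open>[23y] = y\<^sub>1\<close>, \<open>[13y] = - p\<^sub>4\<^sub>5 y\<^sub>2\<close> and \<open>[12y] = p\<^sub>4\<^sub>5 y\<^sub>3\<close>. The entries of
the columns \<open>v\<^sub>4\<close>, \<open>v\<^sub>5\<close> and \<open>x\<close> are obtained by solving these equations for the prescribed values of the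
minors; for \<open>x\<close> the minor \<open>\<ell>\<^sub>i\<^sub>j\<close> is to be \<open>F\<^sub>i\<^sub>j E\<^sub>i E\<^sub>j\<close>. Only \<open>p\<^sub>4\<^sub>5\<close> is inverted.\<close>

primrec chart_entry :: "vx_var \<Rightarrow> (cox_var, 'k::field) laurent"
  where
    "chart_entry (V_entry r i) =
      (if i = 1 then if r = 1 then monomial P45 1 else 0
       else if i = 2 then if r = 2 then 1 else 0
       else if i = 3 then if r = 3 then 1 else 0
       else if i = 4 then
         if r = 1 then monomial P15 1
         else if r = 2 then - (monomial P25 1 * monomial P45 (- 1))
         else monomial P35 1 * monomial P45 (- 1)
       else
         if r = 1 then monomial P14 1
         else if r = 2 then - (monomial P24 1 * monomial P45 (- 1))
         else monomial P34 1 * monomial P45 (- 1))"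
  | "chart_entry (x_entry r) =
      (if r = 1 then monomial F23 1 * monomial E2 1 * monomial E3 1
       else if r = 2 then - (monomial F13 1 * monomial E1 1 * monomial E3 1 * monomial P45 (- 1))
       else monomial F12 1 * monomial E1 1 * monomial E2 1 * monomial P45 (- 1))"

text \<open>The \<open>t\<^sub>i\<close> occur with negative exponents, which a substitution of ring elements does not cover:
instead the exponent vector is mapped, the exponent of \<open>t\<^sub>i\<close> becoming that of \<open>E\<^sub>i\<close>.\<close>

definition chart :: "'k::field target \<Rightarrow> (cox_var, 'k) laurent"
  where "chart = monoid_ring_extension (poly_subst const chart_entry)
    (\<lambda>m. Poly_Mapping.single (\<Sum>i\<in>UNIV. Poly_Mapping.single (exceptional i) (Poly_Mapping.lookup m i)) 1)"

interpretation chart_coeff: unital_ring_hom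
  "poly_subst const chart_entry :: 'k::field vx_poly \<Rightarrow> (cox_var, 'k) laurent"
  by (rule const.unital_ring_hom_poly_subst)

interpretation chart: unital_ring_hom "chart :: 'k::field target \<Rightarrow> (cox_var, 'k) laurent"
  unfolding chart_def
  by (rule chart_coeff.unital_ring_hom_monoid_ring_extension)
    (simp_all add: lookup_add single_add sum.distrib mult_single)

lemma chart_const: "chart (const f) = poly_subst const chart_entry f"
  unfolding chart_def const_def[of f] chart_coeff.monoid_ring_extension_single by simp

lemma chart_t_power: "chart (t_power i e) = monomial (exceptional i) e"
proof -
  have "(\<Sum>j\<in>UNIV. Poly_Mapping.single (exceptional j) (Poly_Mapping.lookup (Poly_Mapping.single i e) j))
      = (\<Sum>j\<in>UNIV. if j = i then Poly_Mapping.single (exceptional i) e else 0)"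
    by (rule sum.cong) (auto simp: lookup_single when_def)
  then show ?thesis
    unfolding chart_def t_power_def chart_coeff.monoid_ring_extension_single
    by (simp add: monomial_def)
qed

lemmas chart_simps = chart_const chart_t_power bracket_def ell_def det_columns_def det_3
  transpose_def vector_3 column_def V_matrix_def x_vector_def exceptional_def

text \<open>\<open>P45\<close> stands for \<open>[123]\<close>; the nine other \<open>P\<close> and \<open>F\<close> stand for the minors that arise from \<open>[123]\<close> by
replacing one column with \<open>v\<^sub>4\<close>, \<open>v\<^sub>5\<close> or \<open>x\<close>.\<close>

definition free_vars :: "cox_var set"
  where "free_vars = {P14, P15, P24, P25, P34, P35, P45, E1, E2, E3, E4, E5, F12, F13, F23}"

text \<open>The algebraic independence of the images of the free variables, in the form of a left
inverse: the chart takes each image back to its variable.\<close>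

lemma chart_cox_image_free:
  assumes "v \<in> free_vars"
  shows "chart (cox_image v :: 'k::field target) = monomial v 1"
  using assms unfolding free_vars_def
  by (elim insertE emptyE)
    (simp_all add: chart_simps mult.assoc monomial_cancel monomial_commute[where d = 1 and e = "- 1"])

section \<open>Elimination of the dependent variables\<close>

abbreviation all_vars :: "'k::field cox_poly"
  where "all_vars \<equiv> \<Prod>v\<in>UNIV. Var v"

text \<open>The polynomials on which the chart inverts \<open>cox_map\<close>. As the equalizer of two ring
homomorphisms this is a subring, it contains the polynomials in the free variables, and \<open>cox_map\<close> is
injective on it; so supports of polynomials need not be traced through the elimination.\<close>

definition chart_subring :: "'k::field cox_poly set"
  where "chart_subring = {f. chart (cox_map f) = laurent_embedding f}"

lemma Var_in_chart_subring: "v \<in> free_vars \<Longrightarrow> Var v \<in> chart_subring"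
  by (simp add: chart_subring_def chart_cox_image_free)

lemma const_in_chart_subring: "const a \<in> chart_subring"
  by (simp add: chart_subring_def chart_const)

lemma cox_map_injective_on_chart_subring:
  assumes "f \<in> chart_subring" "cox_map f = 0"
  shows "f = 0"
proof -
  have "laurent_embedding f = 0"
    using assms by (simp add: chart_subring_def)
  then show ?thesis
    by simp
qed

text \<open>The denominators: elements that become units once the product of all variables is inverted.
The cofactor of the divisibility is what later turns \<open>u f\<close> into a power of that product times \<open>f\<close>.\<close>

definition chart_units :: "'k::field cox_poly set"
  where "chart_units = {u \<in> chart_subring. \<exists>n. u dvd all_vars ^ n}"

lemma chart_units_mult:
  assumes "u \<in> chart_units" "u' \<in> chart_units"
  shows "u * u' \<in> chart_units"
proof -
  obtain n n' where "u dvd all_vars ^ n" "u' dvd all_vars ^ n'"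
    using assms by (auto simp: chart_units_def)
  then have "u * u' dvd all_vars ^ (n + n')"
    by (simp add: power_add mult_dvd_mono)
  then show ?thesis
    using assms by (auto simp: chart_units_def chart_subring_def)
qed

lemma Var_in_chart_units: "v \<in> free_vars \<Longrightarrow> Var v \<in> chart_units"
proof -
  assume v: "v \<in> free_vars"
  have "Var v dvd (all_vars :: 'a cox_poly) ^ 1"
    by (simp add: dvd_prodI)
  then show ?thesis
    using v by (auto simp only: chart_units_def mem_Collect_eq intro: Var_in_chart_subring)
qed

abbreviation trinomial_ideal :: "'k::field cox_poly set"
  where "trinomial_ideal \<equiv> ideal_generated trinomials"

interpretation elimination chart_units chart_subring "trinomial_ideal :: 'k::field cox_poly set"
proof
  show "(1 :: 'k cox_poly) \<in> chart_units"
    by (auto simp: chart_units_def chart_subring_def)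
qed (auto simp: chart_units_mult ideal_generated_def module.span_zero[OF module_times]
    module.span_add[OF module_times] module.span_scale[OF module_times],
    auto simp: chart_units_def chart_subring_def)

lemma trinomial_in_ideal: "f \<in> trinomials \<Longrightarrow> f \<in> trinomial_ideal"
  by (simp add: ideal_generated_def module.span_base[OF module_times])

text \<open>The eleven dependent variables are eliminated one at a time, each with a trinomial that is
linear in it. The order matters: first come the three \<open>p\<^sub>i\<^sub>j\<close> and six \<open>F\<^sub>i\<^sub>j\<close> whose minors have just one
column among \<open>v\<^sub>1, v\<^sub>2, v\<^sub>3\<close>, with trinomials whose other variables are free; then come \<open>F\<^sub>4\<^sub>5\<close> and \<open>G\<close>,
whose trinomials contain variables eliminated before.\<close>

lemma Var_clearable: "(Var v :: 'k::field cox_poly) \<in> clearable"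
proof -
  let ?X = "Var :: cox_var \<Rightarrow> 'k cox_poly"
  have free: "?X w \<in> clearable" if "w \<in> free_vars" for w
    using that by (intro clearable_base Var_in_chart_subring)
  have eliminate: "?X w \<in> clearable"
    if "f \<in> trinomials" "s * f = u * ?X w - p" "u \<in> chart_units" "p \<in> clearable" for w s u f p
    using clearable_step[of u "?X w" p] I_mult[OF trinomial_in_ideal[OF that(1)], of s] that by simp
  note closed = clearable_add clearable_diff clearable_mult free Var_in_chart_units chart_units_mult
  have P23: "?X P23 \<in> clearable"
    by (rule eliminate[where s = 1 and u = "?X P45"
          and f = "?X P23 * ?X P45 - ?X P24 * ?X P35 + ?X P25 * ?X P34"
          and p = "?X P24 * ?X P35 - ?X P25 * ?X P34"])
      (simp only: trinomials_def insert_iff simp_thms, simp add: algebra_simps,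
        auto simp: free_vars_def intro!: closed)
  have P13: "?X P13 \<in> clearable"
    by (rule eliminate[where s = 1 and u = "?X P45"
          and f = "?X P13 * ?X P45 - ?X P14 * ?X P35 + ?X P15 * ?X P34"
          and p = "?X P14 * ?X P35 - ?X P15 * ?X P34"])
      (simp only: trinomials_def insert_iff simp_thms, simp add: algebra_simps,
        auto simp: free_vars_def intro!: closed)
  have P12: "?X P12 \<in> clearable"
    by (rule eliminate[where s = 1 and u = "?X P45"
          and f = "?X P12 * ?X P45 - ?X P14 * ?X P25 + ?X P15 * ?X P24"
          and p = "?X P14 * ?X P25 - ?X P15 * ?X P24"])
      (simp only: trinomials_def insert_iff simp_thms, simp add: algebra_simps,
        auto simp: free_vars_def intro!: closed)
  \<comment> \<open>The quadratic relations among the \<open>F\<^sub>i\<^sub>j\<close> would bring in several dependent variables at once;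
    the relations chosen here, linear in the \<open>F\<^sub>i\<^sub>j\<close>, contain a single one.\<close>
  have F14: "?X F14 \<in> clearable"
    by (rule eliminate[where s = 1 and u = "?X P45 * ?X E4"
          and f = "?X P25 * ?X F12 * ?X E2 - ?X P35 * ?X F13 * ?X E3 + ?X P45 * ?X F14 * ?X E4"
          and p = "?X P35 * ?X F13 * ?X E3 - ?X P25 * ?X F12 * ?X E2"])
      (simp only: trinomials_def insert_iff simp_thms, simp add: algebra_simps,
        auto simp: free_vars_def intro!: closed)
  have F15: "?X F15 \<in> clearable"
    by (rule eliminate[where s = 1 and u = "?X P45 * ?X E5"
          and f = "?X P24 * ?X F12 * ?X E2 - ?X P34 * ?X F13 * ?X E3 + ?X P45 * ?X F15 * ?X E5"
          and p = "?X P34 * ?X F13 * ?X E3 - ?X P24 * ?X F12 * ?X E2"])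
      (simp only: trinomials_def insert_iff simp_thms, simp add: algebra_simps,
        auto simp: free_vars_def intro!: closed)
  have F24: "?X F24 \<in> clearable"
    by (rule eliminate[where s = 1 and u = "?X P45 * ?X E4"
          and f = "?X P15 * ?X F12 * ?X E1 - ?X P35 * ?X F23 * ?X E3 + ?X P45 * ?X F24 * ?X E4"
          and p = "?X P35 * ?X F23 * ?X E3 - ?X P15 * ?X F12 * ?X E1"])
      (simp only: trinomials_def insert_iff simp_thms, simp add: algebra_simps,
        auto simp: free_vars_def intro!: closed)
  have F25: "?X F25 \<in> clearable"
    by (rule eliminate[where s = 1 and u = "?X P45 * ?X E5"
          and f = "?X P14 * ?X F12 * ?X E1 - ?X P34 * ?X F23 * ?X E3 + ?X P45 * ?X F25 * ?X E5"
          and p = "?X P34 * ?X F23 * ?X E3 - ?X P14 * ?X F12 * ?X E1"])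
      (simp only: trinomials_def insert_iff simp_thms, simp add: algebra_simps,
        auto simp: free_vars_def intro!: closed)
  have F34: "?X F34 \<in> clearable"
    by (rule eliminate[where s = 1 and u = "?X P45 * ?X E4"
          and f = "?X P15 * ?X F13 * ?X E1 - ?X P25 * ?X F23 * ?X E2 + ?X P45 * ?X F34 * ?X E4"
          and p = "?X P25 * ?X F23 * ?X E2 - ?X P15 * ?X F13 * ?X E1"])
      (simp only: trinomials_def insert_iff simp_thms, simp add: algebra_simps,
        auto simp: free_vars_def intro!: closed)
  have F35: "?X F35 \<in> clearable"
    by (rule eliminate[where s = 1 and u = "?X P45 * ?X E5"
          and f = "?X P14 * ?X F13 * ?X E1 - ?X P24 * ?X F23 * ?X E2 + ?X P45 * ?X F35 * ?X E5"
          and p = "?X P24 * ?X F23 * ?X E2 - ?X P14 * ?X F13 * ?X E1"])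
      (simp only: trinomials_def insert_iff simp_thms, simp add: algebra_simps,
        auto simp: free_vars_def intro!: closed)
  \<comment> \<open>The coefficients of \<open>F\<^sub>4\<^sub>5\<close> and \<open>G\<close> are \<open>F\<^sub>1\<^sub>2\<close> and \<open>- E\<^sub>1\<close>; the trinomial with \<open>G\<close> is
    used with the opposite sign.\<close>
  have F45: "?X F45 \<in> clearable"
    by (rule eliminate[where s = 1 and u = "?X F12"
          and f = "?X F12 * ?X F45 - ?X F14 * ?X F25 + ?X F15 * ?X F24"
          and p = "?X F14 * ?X F25 - ?X F15 * ?X F24"])
      (simp only: trinomials_def insert_iff simp_thms, simp add: algebra_simps,
        auto simp: free_vars_def intro!: closed F14 F15 F24 F25)
  have G: "?X G \<in> clearable"
    by (rule eliminate[where s = "- 1" and u = "?X E1"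
          and f = "?X P23 * ?X P45 * ?X F24 * ?X F35 - ?X P24 * ?X P35 * ?X F23 * ?X F45 - ?X G * ?X E1"
          and p = "?X P23 * ?X P45 * ?X F24 * ?X F35 - ?X P24 * ?X P35 * ?X F23 * ?X F45"])
      (simp only: trinomials_def insert_iff simp_thms, simp add: algebra_simps,
        auto simp: free_vars_def intro!: closed P23 F24 F35 F45)
  show ?thesis
    using P12 P13 P23 F14 F15 F24 F25 F34 F35 F45 G free
    by (cases v) (simp_all add: free_vars_def)
qed

theorem proposition2p1:
  shows "saturation (ideal_generated (trinomials :: 'k::field_char_0 cox_poly set))
             (\<Prod>v\<in>UNIV. Var v)
       = saturation (universal_cox_ideal :: 'k cox_poly set) (\<Prod>v\<in>UNIV. Var v)"
proof -
  have kernel: "trinomial_ideal \<subseteq> (universal_cox_ideal :: 'k cox_poly set)"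
    unfolding ideal_generated_def
  proof (rule module.span_minimal[OF module_times])
    show "trinomials \<subseteq> (universal_cox_ideal :: 'k cox_poly set)"
      by (auto simp: universal_cox_ideal_def cox_map_trinomial_eq_0)
    show "module.subspace (*) (universal_cox_ideal :: 'k cox_poly set)"
      by (auto simp: module.subspace_def[OF module_times] universal_cox_ideal_def)
  qed
  have clearable_UNIV: "f \<in> clearable" for f :: "'k cox_poly"
    by (rule mpoly_closed_induct)
      (auto intro: clearable_base const_in_chart_subring Var_clearable clearable_add clearable_mult)
  have "\<exists>n. all_vars ^ n * f \<in> trinomial_ideal" if "cox_map f = 0" for f :: "'k cox_poly"
  proof -
    obtain u g where u: "u \<in> chart_units" and g: "g \<in> chart_subring"
      and diff: "u * f - g \<in> trinomial_ideal"
      using clearable_UNIV[of f] by (auto simp: clearable_def)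
    have "cox_map (u * f - g) = 0"
      using diff kernel by (auto simp: universal_cox_ideal_def)
    then have "g = 0"
      using that by (intro cox_map_injective_on_chart_subring[OF g]) simp
    obtain n c where "all_vars ^ n = u * c"
      using u by (auto simp: chart_units_def)
    then have "all_vars ^ n * f = c * (u * f - g)"
      using \<open>g = 0\<close> by (simp add: mult_ac)
    then show ?thesis
      using I_mult[OF diff, of c] by metis
  qed
  then have "\<exists>n. all_vars ^ n * f \<in> trinomial_ideal"
    if "all_vars ^ m * f \<in> universal_cox_ideal" for m and f :: "'k cox_poly"
    using that unfolding universal_cox_ideal_def
    by (metis (mono_tags, lifting) mem_Collect_eq mult.assoc power_add)
  then show ?thesis
    using kernel unfolding saturation_def by blast
qed

end
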